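(* Let $p\ge1$, $L_g\ge0$. For every $t\ge0$ let $0<m_t\le L_t$, $\sigma_t\ge0$, $c_t\ge0$, $\alpha_t>0$. For all $t$ assume: (i) $f_t:\mathbb R^p\to\mathbb R$ is $L_t$-smooth and $m_t$-strongly convex; (ii) $g_t:\mathbb R^p\to\mathbb R$ is convex and $L_g$-Lipschitz; (iii) $\|x_{t+1}^*-x_t^*\|\le\sigma_t$, where $x_t^*$ is the global minimizer of $f_t+g_t$; (iv) $\mathbb E\|v_t\|^2\le c_t^2$. Consider the inexact proximal online gradient descent iteration, with deterministic $x_0$, $$x_{t+1}=\arg\min_{x\in\mathbb R^p}\left\{\frac1{2\alpha_t}\|x-x_t+\alpha_t(\nabla f_t(x_t)+v_t)\|^2+g_t(x)\right\}.$$ If there exist non-negative scalars $\rho_t$ and $\{\lambda_t^{(j)}\}_{j=1}^5$ such that $\begin{bmatrix}Q_t&S_t\\S_t^T&R_t\end{bmatrix}\preceq0$, where $$Q_t=\begin{bmatrix}1-\rho_t^2-2\lambda_t^{(1)}L_tm_t&\lambda_t^{(1)}(L_t+m_t)-\alpha_t\\\lambda_t^{(1)}(L_t+m_t)-\alpha_t&\alpha_t^2-2\lambda_t^{(1)}\end{bmatrix},\quad S_t=\begin{bmatrix}\lambda_t^{(5)}-\alpha_t&-\alpha_t&-\alpha_t&1\\\alpha_t^2-\alpha_t\lambda_t^{(5)}&\alpha_t^2&\alpha_t^2&-\alpha_t\end{bmatrix},$$ $$R_t=\begin{bmatrix}\alpha_t^2-2\alpha_t\lambda_t^{(5)}&\alpha_t^2-\alpha_t\lambda_t^{(5)}&\alpha_t^2-\alpha_t\lambda_t^{(5)}&\lambda_t^{(5)}-\alpha_t\\\alpha_t^2-\alpha_t\lambda_t^{(5)}&\alpha_t^2-\lambda_t^{(4)}&\alpha_t^2&-\alpha_t\\\alpha_t^2-\alpha_t\lambda_t^{(5)}&\alpha_t^2&\alpha_t^2-\lambda_t^{(3)}&-\alpha_t\\\lambda_t^{(5)}-\alpha_t&-\alpha_t&-\alpha_t&1-\lambda_t^{(2)}\end{bmatrix},$$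 then $$\mathbb E\|x_{t+1}-x_{t+1}^*\|^2\le\rho_t^2\,\mathbb E\|x_t-x_t^*\|^2+\lambda_t^{(2)}\sigma_t^2+\lambda_t^{(3)}c_t^2+4\lambda_t^{(4)}L_g^2.$$
   Context: A differentiable $f$ is $L$-smooth if $\|\nabla f(x)-\nabla f(y)\|\le L\|x-y\|$ for all $x,y$, and $m$-strongly convex if $f(x)\ge f(y)+\nabla f(y)^T(x-y)+\frac m2\|x-y\|^2$ for all $x,y$. The functions $f_t,g_t$ are deterministic and the $v_t$ are random vectors in $\mathbb R^p$. $P\preceq0$ means the symmetric matrix $P$ is negative semidefinite; norms are Euclidean. *)

theory Defs
  imports "HOL-Probability.Probability"
begin

text \<open>Well defined at every point of differentiability, where the \<open>GDERIV\<close> vector is unique.\<close>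

definition grad :: "('a::euclidean_space \<Rightarrow> real) \<Rightarrow> 'a \<Rightarrow> 'a" where
  "grad f x = (THE D. GDERIV f x :> D)"

definition L_smooth :: "real \<Rightarrow> ('a::euclidean_space \<Rightarrow> real) \<Rightarrow> bool" where
  "L_smooth L f \<longleftrightarrow> (\<forall>x. f differentiable (at x)) \<and>
     (\<forall>x y. norm (grad f x - grad f y) \<le> L * norm (x - y))"

definition strongly_convex :: "real \<Rightarrow> ('a::euclidean_space \<Rightarrow> real) \<Rightarrow> bool" where
  "strongly_convex m f \<longleftrightarrow> (\<forall>x. f differentiable (at x)) \<and>
     (\<forall>x y. f x \<ge> f y + grad f y \<bullet> (x - y) + m / 2 * (norm (x - y))\<^sup>2)"

definition neg_semidef :: "real^'n^'n \<Rightarrow> bool" where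
  "neg_semidef P \<longleftrightarrow> transpose P = P \<and> (\<forall>z. z \<bullet> (P *v z) \<le> 0)"

text \<open>The block matrix with block rows \<open>A B\<close> and \<open>C D\<close>; the two parts of the index range
  are the two summands of the index type.\<close>

definition block_matrix ::
  "'c^'a^'m \<Rightarrow> 'c^'b^'m \<Rightarrow> 'c^'a^'n \<Rightarrow> 'c^'b^'n \<Rightarrow> 'c^('a + 'b)^('m + 'n)" where
  "block_matrix A B C D = (\<chi> i j.
     case i of
       Inl k \<Rightarrow> (case j of Inl l \<Rightarrow> A $ k $ l | Inr l \<Rightarrow> B $ k $ l)
     | Inr k \<Rightarrow> (case j of Inl l \<Rightarrow> C $ k $ l | Inr l \<Rightarrow> D $ k $ l))"

text \<open>The matrices are listed by rows.  The last arguments \<open>l1, \<dots>, l5\<close> are the multipliers.\<close>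

definition Qmat :: "real \<Rightarrow> real \<Rightarrow> real \<Rightarrow> real \<Rightarrow> real \<Rightarrow> real^2^2" where
  "Qmat L m \<alpha> \<rho> l1 = vector [
     vector [1 - \<rho>\<^sup>2 - 2 * l1 * L * m, l1 * (L + m) - \<alpha>],
     vector [l1 * (L + m) - \<alpha>, \<alpha>\<^sup>2 - 2 * l1]]"

definition Smat :: "real \<Rightarrow> real \<Rightarrow> real^4^2" where
  "Smat \<alpha> l5 = vector [
     vector [l5 - \<alpha>, - \<alpha>, - \<alpha>, 1],
     vector [\<alpha>\<^sup>2 - \<alpha> * l5, \<alpha>\<^sup>2, \<alpha>\<^sup>2, - \<alpha>]]"

definition Rmat :: "real \<Rightarrow> real \<Rightarrow> real \<Rightarrow> real \<Rightarrow> real \<Rightarrow> real^4^4" where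
  "Rmat \<alpha> l2 l3 l4 l5 = vector [
     vector [\<alpha>\<^sup>2 - 2 * \<alpha> * l5, \<alpha>\<^sup>2 - \<alpha> * l5, \<alpha>\<^sup>2 - \<alpha> * l5, l5 - \<alpha>],
     vector [\<alpha>\<^sup>2 - \<alpha> * l5, \<alpha>\<^sup>2 - l4, \<alpha>\<^sup>2, - \<alpha>],
     vector [\<alpha>\<^sup>2 - \<alpha> * l5, \<alpha>\<^sup>2, \<alpha>\<^sup>2 - l3, - \<alpha>],
     vector [l5 - \<alpha>, - \<alpha>, - \<alpha>, 1 - l2]]"

end

theory Submission
  imports Defs
begin

text \<open>Let \<open>x, x'\<close> be the old and new iterates and \<open>xs, xs'\<close> the old and new minimizers.  Then \<open>x' - xs'\<close> is
  \<open>n = e - \<alpha> (u + r + q + w) + d\<close>, where \<open>e = x - xs\<close>, \<open>u\<close> is the difference of the gradients of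
  \<open>f\<close> at \<open>x\<close> and \<open>xs\<close>, \<open>w\<close> is the noise, \<open>d = xs - xs'\<close>, and \<open>r + q\<close> is the difference of the
  subgradients of \<open>g\<close> at \<open>x'\<close> and \<open>xs\<close>, split at a subgradient of \<open>g\<close> at \<open>xs'\<close>.  Smoothness and
  strong convexity of \<open>f\<close> give \<open>(L + m) \<langle>u, e\<rangle> \<ge> L m \<parallel>e\<parallel>\<^sup>2 + \<parallel>u\<parallel>\<^sup>2\<close>, convexity of \<open>g\<close> gives
  \<open>\<langle>r, n\<rangle> \<ge> 0\<close>, and the Lipschitz bound gives \<open>\<parallel>q\<parallel> \<le> 2 Lg\<close>.  The matrix inequality, applied in
  each coordinate and summed, is the S-procedure certificate that combines these into a pointwise
  bound on \<open>\<parallel>n\<parallel>\<^sup>2\<close>.  Nonexpansiveness of the proximal operator makes the iterates measurable and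
  square integrable, so expectations can be taken.\<close>

section \<open>Subgradients and first-order optimality\<close>

definition subgradient :: "('a::real_inner \<Rightarrow> real) \<Rightarrow> 'a \<Rightarrow> 'a \<Rightarrow> bool" where
  "subgradient g x q \<longleftrightarrow> (\<forall>y. g x + q \<bullet> (y - x) \<le> g y)"

lemma subgradient_monotone:
  assumes "subgradient g x q" "subgradient g y r"
  shows "0 \<le> (q - r) \<bullet> (x - y)"
proof -
  have "g x + q \<bullet> (y - x) \<le> g y" "g y + r \<bullet> (x - y) \<le> g x"
    using assms by (auto simp: subgradient_def)
  then show ?thesis
    by (simp add: inner_diff)
qed

text \<open>Testing the subgradient inequality at \<open>x + q\<close> bounds the square of
  \<open>norm q\<close> by \<open>K * norm q\<close>.\<close>

lemma norm_subgradient_le: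
  fixes g :: "'a::real_inner \<Rightarrow> real"
  assumes lip: "K-lipschitz_on UNIV g" and sub: "subgradient g x q"
  shows "norm q \<le> K"
proof (cases "q = 0")
  case True
  then show ?thesis
    using lipschitz_on_nonneg[OF lip] by simp
next
  case False
  have "norm q * norm q = q \<bullet> q"
    by (simp add: norm_eq_sqrt_inner)
  also have "\<dots> \<le> g (x + q) - g x"
    using sub[unfolded subgradient_def, rule_format, of "x + q"] by simp
  also have "\<dots> \<le> K * norm q"
    using lipschitz_onD[OF lip, of "x + q" x] by (simp add: dist_norm)
  finally show ?thesis
    using False by simp
qed

lemma GDERIV_along_line:
  assumes "GDERIV F (x + s *\<^sub>R d) :> D"
  shows "((\<lambda>s. F (x + s *\<^sub>R d)) has_real_derivative d \<bullet> D) (at s)"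
proof -
  have "((\<lambda>s. x + s *\<^sub>R d) has_derivative (\<lambda>h. h *\<^sub>R d)) (at s)"
    by (auto intro!: derivative_eq_intros)
  from has_derivative_compose[OF this assms[unfolded gderiv_def]]
  show ?thesis
    by (simp add: has_field_derivative_def mult.commute[of _ "d \<bullet> D"])
qed

text \<open>A failure at \<open>y\<close> would give \<open>F\<close> plus the chord of
  \<open>g\<close> a negative slope at \<open>x\<close> towards \<open>y\<close>. Convexity keeps
  \<open>g\<close> below its chord, so the objective would drop as well.\<close>

lemma subgradient_at_minimizer:
  fixes F g :: "'a::real_inner \<Rightarrow> real"
  assumes F: "GDERIV F x :> d" and g: "convex_on UNIV g"
    and min: "\<And>y. F x + g x \<le> F y + g y"
  shows "subgradient g x (- d)"
  unfolding subgradient_def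
proof
  fix y
  define \<phi> where "\<phi> h = F (x + h *\<^sub>R (y - x)) + h * (g y - g x)" for h
  have der: "(\<phi> has_real_derivative (y - x) \<bullet> d + (g y - g x)) (at 0)"
  proof -
    have "((\<lambda>h. F (x + h *\<^sub>R (y - x))) has_real_derivative (y - x) \<bullet> d) (at 0)"
      using F by (intro GDERIV_along_line) simp
    then show ?thesis
      unfolding \<phi>_def by (auto intro!: derivative_eq_intros)
  qed
  have "0 \<le> (y - x) \<bullet> d + (g y - g x)"
  proof (rule ccontr)
    assume "\<not> ?thesis"
    with DERIV_neg_dec_right[OF der] obtain \<delta>
      where \<delta>: "\<delta> > 0" "\<And>h. h > 0 \<Longrightarrow> h < \<delta> \<Longrightarrow> \<phi> (0 + h) < \<phi> 0"
      by (meson not_le)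
    \<comment> \<open>The cap at 1 keeps the point on the segment, where convexity applies.\<close>
    define h where "h = min 1 (\<delta> / 2)"
    have h: "0 < h" "h < \<delta>" "h \<le> 1"
      using \<delta>(1) by (auto simp: h_def)
    have "g ((1 - h) *\<^sub>R x + h *\<^sub>R y) \<le> (1 - h) * g x + h * g y"
      using convex_onD[OF g, of h x y] h by simp
    moreover have "(1 - h) *\<^sub>R x + h *\<^sub>R y = x + h *\<^sub>R (y - x)"
      by (simp add: algebra_simps)
    ultimately have "\<phi> 0 \<le> \<phi> h"
      using min[of "x + h *\<^sub>R (y - x)"] by (simp add: \<phi>_def algebra_simps)
    with \<delta>(2)[of h] h show False
      by simp
  qed
  then show "g x + - d \<bullet> (y - x) \<le> g y"
    by (simp add: inner_commute)
qed

section \<open>The proximal operator of a Lipschitz convex function\<close>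

text \<open>A relation rather than a function: the iterates are given as minimizers, and existence
  and uniqueness are established afterwards.\<close>

definition is_prox :: "real \<Rightarrow> ('a::euclidean_space \<Rightarrow> real) \<Rightarrow> 'a \<Rightarrow> 'a \<Rightarrow> bool" where
  "is_prox \<alpha> g z p \<longleftrightarrow> is_arg_min (\<lambda>y. 1 / (2 * \<alpha>) * (norm (y - z))\<^sup>2 + g y) (\<lambda>y. True) p"

lemma is_prox_subgradient:
  assumes "is_prox \<alpha> g z p" "\<alpha> > 0" "convex_on UNIV g"
  shows "subgradient g p ((1 / \<alpha>) *\<^sub>R (z - p))"
proof -
  have "((\<lambda>y. 1 / (2 * \<alpha>) * ((y - z) \<bullet> (y - z))) has_derivative
      (\<lambda>h. h \<bullet> ((1 / \<alpha>) *\<^sub>R (p - z)))) (at p)"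
    using \<open>\<alpha> > 0\<close>
    by (auto intro!: derivative_eq_intros simp: inner_diff_right inner_commute field_simps)
  then have "GDERIV (\<lambda>y. 1 / (2 * \<alpha>) * (norm (y - z))\<^sup>2) p :> (1 / \<alpha>) *\<^sub>R (p - z)"
    by (simp add: gderiv_def power2_norm_eq_inner)
  from subgradient_at_minimizer[OF this assms(3)] assms(1)
  have "subgradient g p (- ((1 / \<alpha>) *\<^sub>R (p - z)))"
    by (simp add: is_prox_def is_arg_min_linorder)
  then show ?thesis
    by (simp add: scaleR_right_diff_distrib)
qed

text \<open>Converse of the optimality condition: when the square is expanded, its cross term is
  absorbed by the subgradient inequality and a nonnegative square remains.\<close>

lemma subgradient_is_prox:
  assumes sub: "subgradient g p q" and \<alpha>: "\<alpha> > 0"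
  shows "is_prox \<alpha> g (p + \<alpha> *\<^sub>R q) p"
  unfolding is_prox_def is_arg_min_linorder
proof (intro conjI allI impI TrueI)
  fix y
  have "g p + q \<bullet> (y - p) \<le> g y"
    using sub by (simp add: subgradient_def)
  moreover have "0 \<le> 1 / (2 * \<alpha>) * (norm (y - p))\<^sup>2"
    using \<alpha> by simp
  moreover have "1 / (2 * \<alpha>) * (norm (y - (p + \<alpha> *\<^sub>R q)))\<^sup>2
      = 1 / (2 * \<alpha>) * (norm (y - p))\<^sup>2 - q \<bullet> (y - p) + 1 / (2 * \<alpha>) * (norm (p - (p + \<alpha> *\<^sub>R q)))\<^sup>2"
  proof -
    have "y - (p + \<alpha> *\<^sub>R q) = (y - p) - \<alpha> *\<^sub>R q"
      by simp
    then have "(norm (y - (p + \<alpha> *\<^sub>R q)))\<^sup>2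
        = (norm (y - p))\<^sup>2 - 2 * \<alpha> * (q \<bullet> (y - p)) + (norm (p - (p + \<alpha> *\<^sub>R q)))\<^sup>2"
      by (simp only:) (simp add: power2_norm_eq_inner inner_diff inner_commute algebra_simps,
          simp add: power2_eq_square)
    then show ?thesis
      using \<alpha> by (simp only:) (simp add: field_simps)
  qed
  ultimately show "1 / (2 * \<alpha>) * (norm (p - (p + \<alpha> *\<^sub>R q)))\<^sup>2 + g p
      \<le> 1 / (2 * \<alpha>) * (norm (y - (p + \<alpha> *\<^sub>R q)))\<^sup>2 + g y"
    by linarith
qed

text \<open>Monotonicity of subgradients bounds the square of \<open>norm (p - q)\<close> by
  \<open>(z - w) \<bullet> (p - q)\<close>, and Cauchy-Schwarz finishes. The case
  \<open>z = w\<close> gives uniqueness of the proximal point.\<close>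

lemma is_prox_nonexpansive:
  assumes p: "is_prox \<alpha> g z p" and q: "is_prox \<alpha> g w q" and "\<alpha> > 0" "convex_on UNIV g"
  shows "norm (p - q) \<le> norm (z - w)"
proof (cases "p = q")
  case False
  have "0 \<le> ((1 / \<alpha>) *\<^sub>R (z - p) - (1 / \<alpha>) *\<^sub>R (w - q)) \<bullet> (p - q)"
    using assms by (intro subgradient_monotone is_prox_subgradient)
  then have "0 \<le> (1 / \<alpha>) * (((z - w) - (p - q)) \<bullet> (p - q))"
    by (simp add: inner_diff_left algebra_simps)
  then have "0 \<le> ((z - w) - (p - q)) \<bullet> (p - q)"
    using \<open>\<alpha> > 0\<close> by (simp add: zero_le_divide_iff)
  then have "norm (p - q) * norm (p - q) \<le> (z - w) \<bullet> (p - q)"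
    by (simp add: inner_diff_left flip: power2_eq_square power2_norm_eq_inner)
  also have "\<dots> \<le> norm (z - w) * norm (p - q)"
    by (rule norm_cauchy_schwarz)
  finally show ?thesis
    using False by simp
qed simp

lemma is_prox_exists:
  fixes g :: "'a::euclidean_space \<Rightarrow> real"
  assumes \<alpha>: "\<alpha> > 0" and lip: "K-lipschitz_on UNIV g"
  shows "\<exists>p. is_prox \<alpha> g z p"
proof -
  define \<phi> where "\<phi> y = 1 / (2 * \<alpha>) * (norm (y - z))\<^sup>2 + g y" for y
  \<comment> \<open>Beyond this radius the quadratic term outweighs any decrease
    \<open>K * norm (y - z)\<close> of \<open>g\<close>, so a minimizer on the compact ball is
    global.\<close>
  define r where "r = 2 * \<alpha> * K"
  have r: "0 \<le> r"
    using \<alpha> lipschitz_on_nonneg[OF lip] by (simp add: r_def)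
  have "continuous_on (cball z r) \<phi>"
    unfolding \<phi>_def using lipschitz_on_continuous_on[OF lip] \<alpha>
    by (auto intro!: continuous_intros elim: continuous_on_subset)
  then have "\<exists>p\<in>cball z r. \<forall>y\<in>cball z r. \<phi> p \<le> \<phi> y"
    using r by (intro continuous_attains_inf) auto
  then obtain p where p: "\<And>y. y \<in> cball z r \<Longrightarrow> \<phi> p \<le> \<phi> y"
    by blast
  have far: "\<phi> z \<le> \<phi> y" if "y \<notin> cball z r" for y
  proof -
    have "\<bar>g y - g z\<bar> \<le> K * norm (y - z)"
      using lipschitz_onD[OF lip, of y z] by (simp add: dist_norm)
    moreover have "2 * \<alpha> * K * norm (y - z) \<le> norm (y - z) * norm (y - z)"
      using that by (intro mult_right_mono) (auto simp: r_def dist_norm norm_minus_commute)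
    then have "K * norm (y - z) \<le> 1 / (2 * \<alpha>) * (norm (y - z))\<^sup>2"
      using \<alpha> by (simp add: field_simps power2_eq_square)
    ultimately show ?thesis
      by (simp add: \<phi>_def)
  qed
  have "\<phi> p \<le> \<phi> y" for y
    using p[of y] p[of z] far[of y] r by (cases "y \<in> cball z r") auto
  then show ?thesis
    unfolding is_prox_def is_arg_min_linorder by (auto simp: \<phi>_def)
qed

text \<open>By uniqueness \<open>p\<close> is \<open>z\<close> followed by the proximal map, which
  is continuous because it is nonexpansive.\<close>

lemma borel_measurable_is_prox:
  fixes g :: "'a::euclidean_space \<Rightarrow> real"
  assumes \<alpha>: "\<alpha> > 0" and lip: "K-lipschitz_on UNIV g" and conv: "convex_on UNIV g"
    and z: "z \<in> borel_measurable M"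
    and p: "\<And>\<omega>. \<omega> \<in> space M \<Longrightarrow> is_prox \<alpha> g (z \<omega>) (p \<omega>)"
  shows "p \<in> borel_measurable M"
proof -
  obtain P where P: "\<And>w. is_prox \<alpha> g w (P w)"
    using is_prox_exists[OF \<alpha> lip] by metis
  have "1-lipschitz_on UNIV P"
    by (intro lipschitz_onI) (auto simp: dist_norm intro: is_prox_nonexpansive[OF P P \<alpha> conv])
  then have "P \<in> borel_measurable borel"
    by (intro borel_measurable_continuous_onI lipschitz_on_continuous_on)
  then have "(\<lambda>\<omega>. P (z \<omega>)) \<in> borel_measurable M"
    using z by (rule measurable_compose_rev)
  moreover have "p \<omega> = P (z \<omega>)" if "\<omega> \<in> space M" for \<omega>
    using is_prox_nonexpansive[OF p[OF that] P[of "z \<omega>"] \<alpha> conv] by simp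
  ultimately show ?thesis
    by (subst measurable_cong) auto
qed

text \<open>The subgradients \<open>n (x - p\<^sub>n)\<close> at the proximal points \<open>p\<^sub>n\<close> of \<open>x\<close> with step \<open>1 / n\<close> are
  bounded by the Lipschitz constant, so \<open>p\<^sub>n\<close> tends to \<open>x\<close> and any limit point of them works.\<close>

lemma subgradient_exists:
  fixes g :: "'a::euclidean_space \<Rightarrow> real"
  assumes lip: "K-lipschitz_on UNIV g" and conv: "convex_on UNIV g"
  shows "\<exists>q. subgradient g x q"
proof -
  have "\<exists>p. is_prox (1 / real (Suc n)) g x p" for n
    by (rule is_prox_exists[OF _ lip]) simp
  then obtain p where p: "\<And>n. is_prox (1 / real (Suc n)) g x (p n)"
    by metis
  define q where "q n = real (Suc n) *\<^sub>R (x - p n)" for n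
  have sub: "subgradient g (p n) (q n)" for n
    using is_prox_subgradient[OF p _ conv, of n] by (simp add: q_def)
  have "norm (q n) \<le> K" for n
    by (rule norm_subgradient_le[OF lip sub])
  then have "bounded (range q)"
    by (auto simp: bounded_iff)
  then obtain l k where k: "strict_mono k" and l: "(q \<circ> k) \<longlonglongrightarrow> l"
    using bounded_imp_convergent_subsequence by blast
  have "(\<lambda>n. x - inverse (real (Suc (k n))) *\<^sub>R (q \<circ> k) n) \<longlonglongrightarrow> x - 0 *\<^sub>R l"
    by (intro tendsto_intros l LIMSEQ_subseq_LIMSEQ[OF LIMSEQ_inverse_real_of_nat k, unfolded comp_def])
  moreover have "x - inverse (real (Suc (k n))) *\<^sub>R (q \<circ> k) n = p (k n)" for n
    unfolding q_def comp_def by (simp del: of_nat_Suc)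
  ultimately have pk: "(\<lambda>n. p (k n)) \<longlonglongrightarrow> x"
    by simp
  have gk: "(\<lambda>n. g (p (k n))) \<longlonglongrightarrow> g x"
    by (rule continuous_on_tendsto_compose[OF lipschitz_on_continuous_on[OF lip] pk]) auto
  have "g x + l \<bullet> (y - x) \<le> g y" for y
  proof (rule LIMSEQ_le_const2)
    show "(\<lambda>n. g (p (k n)) + (q \<circ> k) n \<bullet> (y - p (k n))) \<longlonglongrightarrow> g x + l \<bullet> (y - x)"
      by (intro tendsto_intros l gk pk)
    show "\<exists>N. \<forall>n\<ge>N. g (p (k n)) + (q \<circ> k) n \<bullet> (y - p (k n)) \<le> g y"
      using sub by (auto simp: subgradient_def)
  qed
  then show ?thesis
    by (auto simp: subgradient_def)
qed

section \<open>Smooth strongly convex functions\<close>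

text \<open>The derivative is represented by a vector built from \<open>Basis\<close>; its
  uniqueness makes the \<open>THE\<close> in \<open>grad\<close> select it.\<close>

lemma GDERIV_grad:
  fixes f :: "'a::euclidean_space \<Rightarrow> real"
  assumes "f differentiable (at x)"
  shows "GDERIV f x :> grad f x"
proof -
  obtain f' where f': "(f has_derivative f') (at x)"
    using assms by (auto simp: differentiable_def)
  interpret f': bounded_linear f'
    using f' by (rule has_derivative_bounded_linear)
  have "f' h = h \<bullet> (\<Sum>b\<in>Basis. f' b *\<^sub>R b)" for h
  proof -
    have "f' h = f' (\<Sum>b\<in>Basis. (h \<bullet> b) *\<^sub>R b)"
      by (simp add: euclidean_representation)
    then show ?thesis
      by (simp add: f'.sum f'.scaleR inner_sum_right mult.commute)
  qed
  then have "f' = (\<lambda>h. h \<bullet> (\<Sum>b\<in>Basis. f' b *\<^sub>R b))"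
    by blast
  with f' have D: "GDERIV f x :> (\<Sum>b\<in>Basis. f' b *\<^sub>R b)"
    unfolding gderiv_def by metis
  have "E = E'" if "GDERIV f x :> E" "GDERIV f x :> E'" for E E'
  proof -
    have "(\<lambda>h. h \<bullet> E) = (\<lambda>h. h \<bullet> E')"
      using that unfolding gderiv_def by (rule has_derivative_unique)
    then have "(E - E') \<bullet> E = (E - E') \<bullet> E'"
      by metis
    then show ?thesis
      by (metis inner_diff_right inner_eq_zero_iff right_minus_eq)
  qed
  then show ?thesis
    unfolding grad_def using D by (metis (mono_tags, lifting) theI)
qed

lemma L_smooth_continuous_grad:
  fixes f :: "'a::euclidean_space \<Rightarrow> real"
  assumes "L_smooth L f"
  shows "continuous_on UNIV (grad f)"
proof (rule lipschitz_on_continuous_on)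
  \<comment> \<open>The absolute value supplies the nonnegative constant that
    \<open>lipschitz_on\<close> demands.\<close>
  show "\<bar>L\<bar>-lipschitz_on UNIV (grad f)"
  proof (rule lipschitz_onI)
    fix x y
    have "norm (grad f x - grad f y) \<le> L * norm (x - y)"
      using assms by (simp add: L_smooth_def)
    also have "\<dots> \<le> \<bar>L\<bar> * norm (x - y)"
      by (intro mult_right_mono) auto
    finally show "dist (grad f x) (grad f y) \<le> \<bar>L\<bar> * dist x y"
      by (simp add: dist_norm)
  qed simp
qed

text \<open>Descent lemma: along the segment, \<open>f\<close> minus its quadratic model has
  nonpositive derivative, by Cauchy-Schwarz and the Lipschitz gradient.\<close>

lemma L_smooth_upper_bound:
  fixes f :: "'a::euclidean_space \<Rightarrow> real"
  assumes smooth: "L_smooth L f"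
  shows "f y \<le> f x + grad f x \<bullet> (y - x) + L / 2 * (norm (y - x))\<^sup>2"
proof -
  define d where "d = y - x"
  define \<phi> where "\<phi> s = f (x + s *\<^sub>R d) - (s * (grad f x \<bullet> d) + L / 2 * (norm d)\<^sup>2 * s\<^sup>2)" for s
  have "\<phi> 1 \<le> \<phi> 0"
  proof (rule DERIV_nonpos_imp_nonincreasing[of 0 1 \<phi>])
    fix s :: real
    assume s: "0 \<le> s" "s \<le> 1"
    have "GDERIV f (x + s *\<^sub>R d) :> grad f (x + s *\<^sub>R d)"
      using smooth by (intro GDERIV_grad) (auto simp: L_smooth_def)
    note der = GDERIV_along_line[OF this]
    have "(\<phi> has_real_derivative
        d \<bullet> grad f (x + s *\<^sub>R d) - (grad f x \<bullet> d + L * (norm d)\<^sup>2 * s)) (at s)"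
      unfolding \<phi>_def by (rule derivative_eq_intros der refl | simp)+
    moreover have "d \<bullet> grad f (x + s *\<^sub>R d) - grad f x \<bullet> d \<le> L * (norm d)\<^sup>2 * s"
    proof -
      have "d \<bullet> grad f (x + s *\<^sub>R d) - grad f x \<bullet> d = d \<bullet> (grad f (x + s *\<^sub>R d) - grad f x)"
        by (simp add: inner_diff inner_commute)
      also have "\<dots> \<le> norm d * norm (grad f (x + s *\<^sub>R d) - grad f x)"
        by (rule norm_cauchy_schwarz)
      also have "\<dots> \<le> norm d * (L * norm (x + s *\<^sub>R d - x))"
        using smooth unfolding L_smooth_def by (intro mult_left_mono norm_ge_zero) blast
      also have "\<dots> = L * (norm d)\<^sup>2 * s"
        using s by (simp add: power2_eq_square)
      finally show ?thesis .
    qed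
    ultimately show "\<exists>D. (\<phi> has_real_derivative D) (at s) \<and> D \<le> 0"
      by (intro exI[of _ "d \<bullet> grad f (x + s *\<^sub>R d) - (grad f x \<bullet> d + L * (norm d)\<^sup>2 * s)"]) auto
  qed simp
  then show ?thesis
    by (simp add: \<phi>_def d_def)
qed

text \<open>The function \<open>h = f - m / 2 * \<parallel>\<cdot>\<parallel>\<^sup>2\<close> is convex and \<open>(L - m)\<close>-smooth; with \<open>d\<close> the difference of
  its gradients, comparing \<open>h (y - \<tau> d)\<close> with its tangents at both points gives
  \<open>2 \<tau> \<parallel>d\<parallel>\<^sup>2 - (L - m) \<tau>\<^sup>2 \<parallel>d\<parallel>\<^sup>2 \<le> \<langle>d, y - x\<rangle>\<close> for all \<open>\<tau>\<close>.\<close>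

lemma smooth_strongly_convex_coercive:
  fixes f :: "'a::euclidean_space \<Rightarrow> real"
  assumes smooth: "L_smooth L f" and strong: "strongly_convex m f" and "m \<le> L"
  shows "L * m * (norm (y - x))\<^sup>2 + (norm (grad f y - grad f x))\<^sup>2
    \<le> (L + m) * ((grad f y - grad f x) \<bullet> (y - x))"
proof -
  define d where "d x y = grad f y - grad f x - m *\<^sub>R (y - x)" for x y
  have half: "\<tau> * (norm (d x y))\<^sup>2 - (L - m) / 2 * \<tau>\<^sup>2 * (norm (d x y))\<^sup>2
      \<le> f y - f x - grad f x \<bullet> (y - x) - m / 2 * (norm (y - x))\<^sup>2" for x y \<tau>
  proof -
    define w where "w = \<tau> *\<^sub>R d x y"
    have lo: "f x + grad f x \<bullet> (y - w - x) + m / 2 * (norm (y - w - x))\<^sup>2 \<le> f (y - w)"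
      using strong by (simp add: strongly_convex_def)
    have up: "f (y - w) \<le> f y - grad f y \<bullet> w + L / 2 * (norm w)\<^sup>2"
      using L_smooth_upper_bound[OF smooth, of "y - w" y] by simp
    have sq: "(norm (y - w - x))\<^sup>2 = (norm (y - x))\<^sup>2 - 2 * ((y - x) \<bullet> w) + (norm w)\<^sup>2"
      by (simp add: power2_norm_eq_inner inner_diff inner_commute algebra_simps)
    from lo[unfolded sq] up have "(grad f y - grad f x) \<bullet> w - m * ((y - x) \<bullet> w) - (L - m) / 2 * (norm w)\<^sup>2
      \<le> f y - f x - grad f x \<bullet> (y - x) - m / 2 * (norm (y - x))\<^sup>2"
      by (simp add: inner_diff algebra_simps add_divide_distrib diff_divide_distrib)
    moreover have "(grad f y - grad f x) \<bullet> w - m * ((y - x) \<bullet> w) = \<tau> * (norm (d x y))\<^sup>2"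
      by (simp add: w_def d_def power2_norm_eq_inner inner_diff_left algebra_simps)
    moreover have "(norm w)\<^sup>2 = \<tau>\<^sup>2 * (norm (d x y))\<^sup>2"
      by (simp add: w_def power_mult_distrib)
    ultimately show ?thesis
      by simp
  qed
  define e where "e = y - x"
  define u where "u = grad f y - grad f x"
  define D where "D = u - m *\<^sub>R e"
  have Dxy: "d x y = D" "d y x = - D"
    by (simp_all add: d_def D_def u_def e_def algebra_simps)
  \<comment> \<open>Adding \<open>half\<close> to its copy with \<open>x\<close> and
    \<open>y\<close> exchanged cancels the function values; \<open>D\<close> changes sign but keeps
    its norm.\<close>
  have main: "2 * \<tau> * (norm D)\<^sup>2 - (L - m) * \<tau>\<^sup>2 * (norm D)\<^sup>2 \<le> D \<bullet> e" for \<tau>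
  proof -
    have "(norm (x - y))\<^sup>2 = e \<bullet> e" "(norm (y - x))\<^sup>2 = e \<bullet> e"
      by (simp_all add: e_def norm_minus_commute flip: power2_norm_eq_inner)
    moreover have "grad f y \<bullet> (x - y) = - (grad f y \<bullet> e)"
      by (simp add: e_def inner_diff)
    moreover have "D \<bullet> e = grad f y \<bullet> e - grad f x \<bullet> e - m * (e \<bullet> e)"
      by (simp add: D_def u_def inner_diff_left)
    ultimately show ?thesis
      using half[where x=x and y=y and \<tau>=\<tau>] half[where x=y and y=x and \<tau>=\<tau>]
      unfolding Dxy norm_minus_cancel e_def[symmetric] by (simp add: field_simps)
  qed
  have "(norm D)\<^sup>2 \<le> (L - m) * (D \<bullet> e)"
  proof (cases "L = m")
    case True
    have "D = 0"
    proof (rule ccontr)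
      assume "D \<noteq> 0"
      \<comment> \<open>For \<open>L = m\<close> the bound is linear in \<open>\<tau>\<close>, and
        this choice makes its left side \<open>D \<bullet> e + 1\<close>.\<close>
      then show False
        using main[of "(D \<bullet> e + 1) / (2 * (norm D)\<^sup>2)"] True by (simp add: field_simps)
    qed
    then show ?thesis
      by simp
  next
    case False
    then have "L - m > 0"
      using \<open>m \<le> L\<close> by simp
    \<comment> \<open>This value maximizes the left side of \<open>main\<close> when
      \<open>D\<close> is nonzero.\<close>
    define \<tau> where "\<tau> = 1 / (L - m)"
    have "(L - m) * \<tau>\<^sup>2 = \<tau>"
      using \<open>L - m > 0\<close> by (simp add: \<tau>_def power2_eq_square)
    then have "\<tau> * (norm D)\<^sup>2 \<le> D \<bullet> e"
      using main[of \<tau>] by simp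
    then show ?thesis
      using \<open>L - m > 0\<close> by (simp add: \<tau>_def field_simps)
  qed
  \<comment> \<open>After substituting \<open>D = u - m *\<^sub>R e\<close>, the terms in
    \<open>m\<^sup>2\<close> cancel.\<close>
  then show ?thesis
    unfolding e_def[symmetric] u_def[symmetric]
    by (simp add: D_def power2_norm_eq_inner inner_diff inner_commute algebra_simps)
qed

section \<open>The matrix inequality\<close>

text \<open>The arguments \<open>e, u, r, q, w, d\<close> are the six coordinates of the block matrix in order:
  displacement from the old minimizer, gradient difference, two parts of the subgradient difference,
  noise, and drift of the minimizer.  Then \<open>n\<close> is the displacement from the new minimizer, and each
  multiplier stands at the inequality that it weights.\<close>

definition lmi_form ::
  "(nat \<Rightarrow> real) \<Rightarrow> real \<Rightarrow> real \<Rightarrow> real \<Rightarrow> real \<Rightarrow>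
   'a::real_inner \<Rightarrow> 'a \<Rightarrow> 'a \<Rightarrow> 'a \<Rightarrow> 'a \<Rightarrow> 'a \<Rightarrow> real" where
  "lmi_form l L m \<alpha> \<rho> e u r q w d =
     (let n = e - \<alpha> *\<^sub>R (u + r + q + w) + d in
       n \<bullet> n - \<rho>\<^sup>2 * (e \<bullet> e) + 2 * l 1 * ((L + m) * (u \<bullet> e) - L * m * (e \<bullet> e) - u \<bullet> u)
       - l 2 * (d \<bullet> d) - l 3 * (w \<bullet> w) - l 4 * (q \<bullet> q) + 2 * l 5 * (r \<bullet> n))"

lemma vector_4:
  "(vector [a, b, c, d] :: 'a::zero^4) $ 1 = a"
  "(vector [a, b, c, d] :: 'a::zero^4) $ 2 = b"
  "(vector [a, b, c, d] :: 'a::zero^4) $ 3 = c"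
  "(vector [a, b, c, d] :: 'a::zero^4) $ 4 = d"
  by (simp_all add: vector_def)

lemma sum_UNIV_Plus:
  fixes h :: "'a::finite + 'b::finite \<Rightarrow> 'c::comm_monoid_add"
  shows "sum h UNIV = (\<Sum>i\<in>UNIV. h (Inl i)) + (\<Sum>i\<in>UNIV. h (Inr i))"
  using sum.Plus[of "UNIV :: 'a set" "UNIV :: 'b set" h] by (simp add: comp_def)

text \<open>For scalars, \<open>lmi_form\<close> is the quadratic form of the block matrix at the
  vector of its six arguments.\<close>

lemma lmi_form_real_nonpos:
  fixes e u r q w d :: real
  assumes "neg_semidef (block_matrix (Qmat L m \<alpha> \<rho> (l 1)) (Smat \<alpha> (l 5))
    (transpose (Smat \<alpha> (l 5))) (Rmat \<alpha> (l 2) (l 3) (l 4) (l 5)))"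
  shows "lmi_form l L m \<alpha> \<rho> e u r q w d \<le> 0"
proof -
  define z :: "real^(2+4)" where
    "z = (\<chi> i. case i of Inl k \<Rightarrow> (vector [e, u] :: real^2) $ k
      | Inr k \<Rightarrow> (vector [r, q, w, d] :: real^4) $ k)"
  have "z \<bullet> (block_matrix (Qmat L m \<alpha> \<rho> (l 1)) (Smat \<alpha> (l 5))
      (transpose (Smat \<alpha> (l 5))) (Rmat \<alpha> (l 2) (l 3) (l 4) (l 5)) *v z)
    = lmi_form l L m \<alpha> \<rho> e u r q w d"
    unfolding inner_vec_def matrix_vector_mult_def sum_UNIV_Plus sum_2 sum_4
    by (simp add: z_def block_matrix_def Qmat_def Smat_def Rmat_def transpose_def vector_4
        lmi_form_def Let_def) algebra
  then show ?thesis
    using assms unfolding neg_semidef_def by metis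
qed

text \<open>Every term is a multiple of an inner product, so the form is the sum of its scalar
  versions over an orthonormal basis. This stands in for a Kronecker product with the
  identity.\<close>

lemma lmi_form_nonpos:
  fixes e u r q w d :: "'a::euclidean_space"
  assumes "\<And>e u r q w d :: real. lmi_form l L m \<alpha> \<rho> e u r q w d \<le> 0"
  shows "lmi_form l L m \<alpha> \<rho> e u r q w d \<le> 0"
proof -
  define n where "n = e - \<alpha> *\<^sub>R (u + r + q + w) + d"
  have n: "e \<bullet> b - \<alpha> *\<^sub>R (u \<bullet> b + r \<bullet> b + q \<bullet> b + w \<bullet> b) + d \<bullet> b = n \<bullet> b" for b
    by (simp add: n_def inner_add_left inner_diff_left)
  have "lmi_form l L m \<alpha> \<rho> e u r q w d
    = (\<Sum>b\<in>Basis. lmi_form l L m \<alpha> \<rho> (e \<bullet> b) (u \<bullet> b) (r \<bullet> b) (q \<bullet> b) (w \<bullet> b) (d \<bullet> b))"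
    unfolding lmi_form_def Let_def n n_def[symmetric] inner_real_def
      euclidean_inner[of n n] euclidean_inner[of e e] euclidean_inner[of u e]
      euclidean_inner[of u u] euclidean_inner[of d d] euclidean_inner[of w w]
      euclidean_inner[of q q] euclidean_inner[of r n]
    by (simp add: sum.distrib sum_subtractf sum_distrib_left right_diff_distrib)
  also have "\<dots> \<le> 0"
    by (intro sum_nonpos assms)
  finally show ?thesis .
qed

section \<open>The iteration\<close>

lemma minimizer_subgradient:
  assumes "L_smooth L f" "convex_on UNIV g" "is_arg_min (\<lambda>y. f y + g y) (\<lambda>y. True) xs"
  shows "subgradient g xs (- grad f xs)"
proof (rule subgradient_at_minimizer)
  show "GDERIV f xs :> grad f xs"
    using assms(1) by (intro GDERIV_grad) (simp add: L_smooth_def)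
qed (use assms in \<open>auto simp: is_arg_min_linorder\<close>)

lemma prox_gradient_step_bound:
  fixes f g :: "'a::euclidean_space \<Rightarrow> real" and l :: "nat \<Rightarrow> real"
  assumes smooth: "L_smooth L f" and strong: "strongly_convex m f" and "m \<le> L" and "\<alpha> > 0"
    and conv: "convex_on UNIV g" and lip: "K-lipschitz_on UNIV g"
    and xs: "is_arg_min (\<lambda>y. f y + g y) (\<lambda>y. True) xs"
    and \<sigma>: "norm (xs' - xs) \<le> \<sigma>"
    and x': "is_prox \<alpha> g (x - \<alpha> *\<^sub>R (grad f x + v)) x'"
    and l: "\<And>j. j \<in> {1..5} \<Longrightarrow> l j \<ge> 0"
    and lmi: "\<And>e u r q w d :: 'a. lmi_form l L m \<alpha> \<rho> e u r q w d \<le> 0"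
  shows "(norm (x' - xs'))\<^sup>2
    \<le> \<rho>\<^sup>2 * (norm (x - xs))\<^sup>2 + l 2 * \<sigma>\<^sup>2 + l 3 * (norm v)\<^sup>2 + 4 * l 4 * K\<^sup>2"
proof -
  \<comment> \<open>Monotonicity against \<open>x' - xs'\<close> needs a subgradient at
    \<open>xs'\<close>, whereas optimality of \<open>xs\<close> gives one at \<open>xs\<close>;
    \<open>p\<close> bridges the two.\<close>
  obtain p where p: "subgradient g xs' p"
    using subgradient_exists[OF lip conv] by blast
  define s where "s = (1 / \<alpha>) *\<^sub>R (x - \<alpha> *\<^sub>R (grad f x + v) - x')"
  have s: "subgradient g x' s"
    unfolding s_def by (rule is_prox_subgradient[OF x' \<open>\<alpha> > 0\<close> conv])
  have s0: "subgradient g xs (- grad f xs)"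
    by (rule minimizer_subgradient[OF smooth conv xs])
  define e u where "e = x - xs" and "u = grad f x - grad f xs"
  define r q where "r = s - p" and "q = p + grad f xs"
  define d where "d = xs - xs'"
  have "\<alpha> *\<^sub>R s = x - \<alpha> *\<^sub>R (grad f x + v) - x'"
    using \<open>\<alpha> > 0\<close> by (simp add: s_def)
  then have n: "e - \<alpha> *\<^sub>R (u + r + q + v) + d = x' - xs'"
    by (simp add: e_def u_def r_def q_def d_def algebra_simps)
  have "0 \<le> r \<bullet> (x' - xs')"
    unfolding r_def by (rule subgradient_monotone[OF s p])
  then have 5: "0 \<le> l 5 * (r \<bullet> (x' - xs'))"
    using l[of 5] by simp
  have "0 \<le> (L + m) * (u \<bullet> e) - L * m * (e \<bullet> e) - u \<bullet> u"
    using smooth_strongly_convex_coercive[OF smooth strong \<open>m \<le> L\<close>, of x xs]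
    by (simp add: e_def u_def power2_norm_eq_inner)
  then have 1: "0 \<le> l 1 * ((L + m) * (u \<bullet> e) - L * m * (e \<bullet> e) - u \<bullet> u)"
    using l[of 1] by simp
  have "norm d \<le> \<sigma>"
    using \<sigma> by (simp add: d_def norm_minus_commute)
  then have 2: "l 2 * (d \<bullet> d) \<le> l 2 * \<sigma>\<^sup>2"
    using l[of 2] by (intro mult_left_mono) (auto simp: power_mono simp flip: power2_norm_eq_inner)
  have "norm q \<le> norm p + norm (- grad f xs)"
    unfolding q_def norm_minus_cancel by (rule norm_triangle_ineq)
  also have "\<dots> \<le> 2 * K"
    using norm_subgradient_le[OF lip p] norm_subgradient_le[OF lip s0] by simp
  finally have "q \<bullet> q \<le> 4 * K\<^sup>2"
    using power_mono[of "norm q" "2 * K" 2] by (simp add: power_mult_distrib power2_norm_eq_inner)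
  then have 4: "l 4 * (q \<bullet> q) \<le> 4 * l 4 * K\<^sup>2"
    using l[of 4] mult_left_mono[of "q \<bullet> q" "4 * K\<^sup>2" "l 4"] by simp
  \<comment> \<open>The facts \<open>1\<close>, \<open>2\<close>, \<open>4\<close>, \<open>5\<close>
    carry the index of their multiplier; the noise term with \<open>l 3\<close> is kept and averaged
    later.\<close>
  show ?thesis
    using lmi[of e u r q v d] 1 2 4 5 unfolding lmi_form_def Let_def n
    by (simp add: power2_norm_eq_inner e_def)
qed

text \<open>The old minimizer \<open>xs\<close> is a fixed point of the exact step, so nonexpansiveness applies.\<close>

lemma prox_gradient_step_dist:
  fixes f g :: "'a::euclidean_space \<Rightarrow> real"
  assumes smooth: "L_smooth L f" and "\<alpha> > 0" and conv: "convex_on UNIV g"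
    and xs: "is_arg_min (\<lambda>y. f y + g y) (\<lambda>y. True) xs"
    and x': "is_prox \<alpha> g (x - \<alpha> *\<^sub>R (grad f x + v)) x'"
  shows "norm (x' - xs) \<le> (1 + \<alpha> * L) * norm (x - xs) + \<alpha> * norm v"
proof -
  have "is_prox \<alpha> g (xs + \<alpha> *\<^sub>R (- grad f xs)) xs"
    using minimizer_subgradient[OF smooth conv xs] \<open>\<alpha> > 0\<close> by (rule subgradient_is_prox)
  with x' have "norm (x' - xs)
      \<le> norm ((x - \<alpha> *\<^sub>R (grad f x + v)) - (xs + \<alpha> *\<^sub>R (- grad f xs)))"
    using \<open>\<alpha> > 0\<close> conv by (rule is_prox_nonexpansive)
  also have "\<dots> = norm ((x - xs) - \<alpha> *\<^sub>R (grad f x - grad f xs) - \<alpha> *\<^sub>R v)"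
    by (simp add: algebra_simps)
  also have "\<dots> \<le> norm (x - xs) + norm (\<alpha> *\<^sub>R (grad f x - grad f xs)) + norm (\<alpha> *\<^sub>R v)"
    by (meson add_right_mono norm_triangle_ineq4 order_trans)
  also have "\<dots> \<le> norm (x - xs) + \<alpha> * (L * norm (x - xs)) + \<alpha> * norm v"
    using smooth \<open>\<alpha> > 0\<close> by (simp add: L_smooth_def)
  finally show ?thesis
    by (simp add: algebra_simps)
qed

lemma norm_add_power2_le:
  fixes a b :: "'a::real_normed_vector"
  shows "(norm (a + b))\<^sup>2 \<le> 2 * (norm a)\<^sup>2 + 2 * (norm b)\<^sup>2"
proof -
  have "(norm (a + b))\<^sup>2 \<le> (norm a + norm b)\<^sup>2"
    by (intro power_mono norm_triangle_ineq) simp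
  also have "\<dots> \<le> 2 * (norm a)\<^sup>2 + 2 * (norm b)\<^sup>2"
    using zero_le_power2[of "norm a - norm b"] by (simp add: power2_eq_square algebra_simps)
  finally show ?thesis .
qed

text \<open>The center \<open>a\<close> is free because the minimizer moves between steps.\<close>

lemma integrable_prox_gradient_step:
  fixes f g :: "'a::euclidean_space \<Rightarrow> real"
  assumes "finite_measure M"
    and smooth: "L_smooth L f" and "\<alpha> > 0" and conv: "convex_on UNIV g"
    and xs: "is_arg_min (\<lambda>y. f y + g y) (\<lambda>y. True) xs"
    and v: "integrable M (\<lambda>\<omega>. (norm (v \<omega>))\<^sup>2)"
    and x: "integrable M (\<lambda>\<omega>. (norm (x \<omega> - xs))\<^sup>2)"
    and x': "\<And>\<omega>. \<omega> \<in> space M \<Longrightarrow> is_prox \<alpha> g (x \<omega> - \<alpha> *\<^sub>R (grad f (x \<omega>) + v \<omega>)) (x' \<omega>)"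
    and meas: "x' \<in> borel_measurable M"
  shows "integrable M (\<lambda>\<omega>. (norm (x' \<omega> - a))\<^sup>2)"
proof (rule Bochner_Integration.integrable_bound)
  interpret finite_measure M by fact
  \<comment> \<open>The factors 4 and 2 come from two uses of \<open>norm_add_power2_le\<close>: one
    splits off \<open>xs - a\<close>, the other separates the old distance from the noise.\<close>
  let ?b = "\<lambda>\<omega>. 4 * (1 + \<alpha> * L)\<^sup>2 * (norm (x \<omega> - xs))\<^sup>2 + 4 * \<alpha>\<^sup>2 * (norm (v \<omega>))\<^sup>2 + 2 * (norm (xs - a))\<^sup>2"
  show "integrable M ?b"
    using v x by simp
  show "(\<lambda>\<omega>. (norm (x' \<omega> - a))\<^sup>2) \<in> borel_measurable M"
    using meas by measurable
  show "AE \<omega> in M. norm ((norm (x' \<omega> - a))\<^sup>2) \<le> norm (?b \<omega>)"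
  proof (rule AE_I2)
    fix \<omega>
    assume "\<omega> \<in> space M"
    note prox = x'[OF this]
    let ?c = "(1 + \<alpha> * L) * norm (x \<omega> - xs)" and ?d = "\<alpha> * norm (v \<omega>)"
    have "(norm (x' \<omega> - xs))\<^sup>2 \<le> (?c + ?d)\<^sup>2"
      by (intro power_mono prox_gradient_step_dist[OF smooth \<open>\<alpha> > 0\<close> conv xs prox]) simp
    also have "\<dots> \<le> 2 * ?c\<^sup>2 + 2 * ?d\<^sup>2"
      using norm_add_power2_le[of ?c ?d] by (simp only: real_norm_def power2_abs)
    finally have "(norm (x' \<omega> - xs))\<^sup>2 \<le> 2 * ?c\<^sup>2 + 2 * ?d\<^sup>2" .
    moreover have "(norm (x' \<omega> - a))\<^sup>2 \<le> 2 * (norm (x' \<omega> - xs))\<^sup>2 + 2 * (norm (xs - a))\<^sup>2"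
      using norm_add_power2_le[of "x' \<omega> - xs" "xs - a"] by simp
    ultimately have "(norm (x' \<omega> - a))\<^sup>2 \<le> ?b \<omega>"
      by (simp add: power_mult_distrib)
    then show "norm ((norm (x' \<omega> - a))\<^sup>2) \<le> norm (?b \<omega>)"
      by simp
  qed
qed

text \<open>Integrability is part of the conclusion because the Bochner integral of a non-integrable
  function is 0, so the inequality alone would not control the second moments.\<close>

theorem lemma5p1:
  fixes M :: "'w measure"
    and f g :: "nat \<Rightarrow> real^'p \<Rightarrow> real"
    and v x :: "nat \<Rightarrow> 'w \<Rightarrow> real^'p"
    and x0 :: "real^'p"
    and xstar :: "nat \<Rightarrow> real^'p"
    and L m \<sigma> c \<alpha> \<rho> :: "nat \<Rightarrow> real"
    and Lg :: real
    and lam :: "nat \<Rightarrow> nat \<Rightarrow> real"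
    and t :: nat
  assumes "prob_space M"
    and "Lg \<ge> 0"
    and "\<And>s. 0 < m s" and "\<And>s. m s \<le> L s"
    and "\<And>s. \<sigma> s \<ge> 0" and "\<And>s. c s \<ge> 0" and "\<And>s. \<alpha> s > 0"
    and "\<And>s. L_smooth (L s) (f s)"
    and "\<And>s. strongly_convex (m s) (f s)"
    and "\<And>s. convex_on UNIV (g s)"
    and "\<And>s. Lg-lipschitz_on UNIV (g s)"
    and "\<And>s. is_arg_min (\<lambda>y. f s y + g s y) (\<lambda>y. True) (xstar s)"
    and "\<And>s. norm (xstar (Suc s) - xstar s) \<le> \<sigma> s"
    and "\<And>s. v s \<in> borel_measurable M"
    and "\<And>s. integrable M (\<lambda>\<omega>. (norm (v s \<omega>))\<^sup>2)"
    and "\<And>s. prob_space.expectation M (\<lambda>\<omega>. (norm (v s \<omega>))\<^sup>2) \<le> (c s)\<^sup>2"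
    and "\<And>\<omega>. \<omega> \<in> space M \<Longrightarrow> x 0 \<omega> = x0"
    and "\<And>s \<omega>. \<omega> \<in> space M \<Longrightarrow>
           is_arg_min
             (\<lambda>y. 1 / (2 * \<alpha> s) *
                (norm (y - x s \<omega> + \<alpha> s *\<^sub>R (grad (f s) (x s \<omega>) + v s \<omega>)))\<^sup>2 + g s y)
             (\<lambda>y. True) (x (Suc s) \<omega>)"
    and "\<rho> t \<ge> 0"
    and "\<And>j. j \<in> {1..5} \<Longrightarrow> lam t j \<ge> 0"
    and "neg_semidef
           (block_matrix
             (Qmat (L t) (m t) (\<alpha> t) (\<rho> t) (lam t 1))
             (Smat (\<alpha> t) (lam t 5))
             (transpose (Smat (\<alpha> t) (lam t 5)))
             (Rmat (\<alpha> t) (lam t 2) (lam t 3) (lam t 4) (lam t 5)))"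
  shows "integrable M (\<lambda>\<omega>. (norm (x t \<omega> - xstar t))\<^sup>2)
    \<and> integrable M (\<lambda>\<omega>. (norm (x (Suc t) \<omega> - xstar (Suc t)))\<^sup>2)
    \<and> prob_space.expectation M (\<lambda>\<omega>. (norm (x (Suc t) \<omega> - xstar (Suc t)))\<^sup>2)
        \<le> (\<rho> t)\<^sup>2 * prob_space.expectation M (\<lambda>\<omega>. (norm (x t \<omega> - xstar t))\<^sup>2)
          + lam t 2 * (\<sigma> t)\<^sup>2 + lam t 3 * (c t)\<^sup>2 + 4 * lam t 4 * Lg\<^sup>2"
proof -
  note smooth = assms(8) and strong = assms(9) and conv = assms(10) and lip = assms(11)
    and xs = assms(12) and v = assms(14) and v2 = assms(15)
  interpret prob_space M by fact
  have prox: "is_prox (\<alpha> s) (g s) (x s \<omega> - \<alpha> s *\<^sub>R (grad (f s) (x s \<omega>) + v s \<omega>)) (x (Suc s) \<omega>)"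
    if "\<omega> \<in> space M" for s \<omega>
    using assms(18)[OF that, of s] unfolding is_prox_def diff_diff_eq2[symmetric]
    by (simp add: algebra_simps)
  have meas: "x s \<in> borel_measurable M" for s
  proof (induction s)
    case 0
    show ?case
      using assms(17) by (subst measurable_cong[where g = "\<lambda>_. x0"]) auto
  next
    case (Suc s)
    have "(\<lambda>\<omega>. grad (f s) (x s \<omega>)) \<in> borel_measurable M"
      using Suc borel_measurable_continuous_onI[OF L_smooth_continuous_grad[OF smooth]]
      by (rule measurable_compose)
    then have "(\<lambda>\<omega>. x s \<omega> - \<alpha> s *\<^sub>R (grad (f s) (x s \<omega>) + v s \<omega>)) \<in> borel_measurable M"
      using Suc v[of s] by measurable
    from borel_measurable_is_prox[OF assms(7) lip conv this prox] show ?case .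
  qed
  \<comment> \<open>An arbitrary center lets the induction hypothesis be used at
    \<open>xstar s\<close>.\<close>
  have int: "integrable M (\<lambda>\<omega>. (norm (x s \<omega> - a))\<^sup>2)" for s a
  proof (induction s arbitrary: a)
    case 0
    show ?case
      using assms(17)
      by (subst Bochner_Integration.integrable_cong[where g = "\<lambda>_. (norm (x0 - a))\<^sup>2", OF refl]) auto
  next
    case (Suc s)
    show ?case
      by (rule integrable_prox_gradient_step[OF finite_measure_axioms smooth assms(7) conv xs v2 Suc
            prox meas])
  qed
  let ?b = "\<lambda>\<omega>. (\<rho> t)\<^sup>2 * (norm (x t \<omega> - xstar t))\<^sup>2 + lam t 2 * (\<sigma> t)\<^sup>2
    + lam t 3 * (norm (v t \<omega>))\<^sup>2 + 4 * lam t 4 * Lg\<^sup>2"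
  have "expectation (\<lambda>\<omega>. (norm (x (Suc t) \<omega> - xstar (Suc t)))\<^sup>2) \<le> expectation ?b"
  proof (rule integral_mono)
    show "integrable M ?b"
      using int v2 by simp
    show "(norm (x (Suc t) \<omega> - xstar (Suc t)))\<^sup>2 \<le> ?b \<omega>" if "\<omega> \<in> space M" for \<omega>
      by (rule prox_gradient_step_bound[OF smooth strong assms(4) assms(7) conv lip xs assms(13)
            prox[OF that] assms(20) lmi_form_nonpos[OF lmi_form_real_nonpos[OF assms(21)]]])
  qed (rule int)
  also have "\<dots> = (\<rho> t)\<^sup>2 * expectation (\<lambda>\<omega>. (norm (x t \<omega> - xstar t))\<^sup>2) + lam t 2 * (\<sigma> t)\<^sup>2
      + lam t 3 * expectation (\<lambda>\<omega>. (norm (v t \<omega>))\<^sup>2) + 4 * lam t 4 * Lg\<^sup>2"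
    using int v2 by (simp add: prob_space)
  \<comment> \<open>The second-moment bound on the noise enters here, weighted by the nonnegative
    \<open>lam t 3\<close>.\<close>
  also have "\<dots> \<le> (\<rho> t)\<^sup>2 * expectation (\<lambda>\<omega>. (norm (x t \<omega> - xstar t))\<^sup>2) + lam t 2 * (\<sigma> t)\<^sup>2
      + lam t 3 * (c t)\<^sup>2 + 4 * lam t 4 * Lg\<^sup>2"
    using mult_left_mono[OF assms(16)[of t] assms(20)[of 3]] by simp
  finally show ?thesis
    using int by blast
qed

end
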